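(* Let $m\ge 1$ and let $\{S_1,\dots,S_m\}$ be any collection of $m$ round two-spheres in $\mathbb{R}^3$. Then $\mathbb{R}^3\setminus\bigcup_{i=1}^m S_i$ has at most $$\frac{m^3}{3}-m^2+\frac{8m}{3}=2\binom{m}{3}+2m$$ connected components.
   Context: A round (two-)sphere in $\mathbb{R}^3$ is a set of the form $\{(x,y,z)\mid (x-x_0)^2+(y-y_0)^2+(z-z_0)^2=r_0^2\}$ with $r_0>0$. No transversality or general position is assumed. *)

theory Defs
  imports "HOL-Analysis.Analysis"
begin

definition round_sphere :: "(real ^ 3) set \<Rightarrow> bool" where
  "round_sphere S \<longleftrightarrow> (\<exists>c r. r > 0 \<and> S = sphere c r)"

lemma sphere_coordinates:
  fixes c :: "real ^ 3"
  assumes "r > 0"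
  shows "sphere c r = {p. (p $ 1 - c $ 1)\<^sup>2 + (p $ 2 - c $ 2)\<^sup>2 + (p $ 3 - c $ 3)\<^sup>2 = r\<^sup>2}"
proof -
  have "dist c p = r \<longleftrightarrow> (p $ 1 - c $ 1)\<^sup>2 + (p $ 2 - c $ 2)\<^sup>2 + (p $ 3 - c $ 3)\<^sup>2 = r\<^sup>2"
    for p :: "real ^ 3"
  proof -
    have "dist c p = r \<longleftrightarrow> (dist c p)\<^sup>2 = r\<^sup>2"
      using assms by (simp add: power2_eq_iff_nonneg)
    also have "(dist c p)\<^sup>2 = (p $ 1 - c $ 1)\<^sup>2 + (p $ 2 - c $ 2)\<^sup>2 + (p $ 3 - c $ 3)\<^sup>2"
      unfolding dist_norm norm_minus_commute[of c p] power2_norm_eq_inner inner_vec_def sum_3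
      by (simp add: power2_eq_square)
    finally show ?thesis .
  qed
  then show ?thesis
    by (auto simp: sphere_def)
qed

lemma round_sphere_coordinates:
  "round_sphere S \<longleftrightarrow> (\<exists>x0 y0 z0 r0. r0 > 0 \<and>
     S = {p. (p $ 1 - x0)\<^sup>2 + (p $ 2 - y0)\<^sup>2 + (p $ 3 - z0)\<^sup>2 = r0\<^sup>2})"
proof
  assume "round_sphere S"
  then show "\<exists>x0 y0 z0 r0. r0 > 0 \<and>
     S = {p. (p $ 1 - x0)\<^sup>2 + (p $ 2 - y0)\<^sup>2 + (p $ 3 - z0)\<^sup>2 = r0\<^sup>2}"
    unfolding round_sphere_def using sphere_coordinates by blast
next
  assume "\<exists>x0 y0 z0 r0. r0 > 0 \<and>
     S = {p. (p $ 1 - x0)\<^sup>2 + (p $ 2 - y0)\<^sup>2 + (p $ 3 - z0)\<^sup>2 = r0\<^sup>2}"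
  then obtain x0 y0 z0 r0 where r: "r0 > 0"
    and S: "S = {p. (p $ 1 - x0)\<^sup>2 + (p $ 2 - y0)\<^sup>2 + (p $ 3 - z0)\<^sup>2 = r0\<^sup>2}"
    by blast
  have "S = sphere (vector [x0, y0, z0]) r0"
    using S sphere_coordinates[OF r, of "vector [x0, y0, z0]"] by (simp add: vector_3)
  with r show "round_sphere S"
    unfolding round_sphere_def by blast
qed

end

theory Submission
  imports Defs
begin

text \<open>Adding the spheres one at a time, a connected piece \<open>D\<close> of the new sphere has a
  tube whose two halves are connected, so removing \<open>D\<close> creates at most one new component.
  Hence the number of components grows by at most the number of pieces into which the
  new sphere is cut by the \<open>k\<close> old ones. These cut it along plane sections, so the same
  argument on the sphere applies: a new circle creates at most as many regions as it has arcs,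
  which is at most \<open>max 1 (2 * k)\<close> after \<open>k\<close> circles since two circles share at most two points.
  A tangency point never separates, and coinciding spheres add nothing.\<close>

subsection \<open>Removing a wall from a locally connected space\<close>

text \<open>An upper bound only asks that each connected piece of a wall has at most two connected
  sides. The obstacle is the missing general position: pieces may end in tangency points or along
  other spheres, and the open set around them may be wild near its boundary. Two-sidedness is
  therefore demanded for every open \<open>U\<close> and every connected, relatively open
  \<open>D\<close> inside it, and established once per type of wall: sphere, circle, point.

  The constants: a circle with no earlier circles is one closed arc, whence \<open>max 1\<close>. A
  sphere cut by k >= 1 circles has at most 1 + 1 + (2 + 4 + ... + 2(k-1)) = k(k-1) + 2 regions, an
  uncut one has 1. Starting from the single component of space, m spheres give at most 1 + 1 +
  2(m-1) plus the sum of k(k-1) over k < m, and that last sum is twice the binomial coefficient of m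
  over 3.\<close>

text \<open>Finiteness is part of the bound because \<open>card\<close> of an infinite set is 0,
  which would make the inequality alone hold for infinitely many components.\<close>

definition components_le :: "'a::topological_space set \<Rightarrow> nat \<Rightarrow> bool" where
  "components_le S n \<longleftrightarrow> finite (components S) \<and> card (components S) \<le> n"

lemma components_le_mono: "components_le S k \<Longrightarrow> k \<le> n \<Longrightarrow> components_le S n"
  by (auto simp: components_le_def)

lemma components_le_empty [simp]: "components_le {} n"
  by (simp add: components_le_def)

text \<open>Every component meets some member of the cover, and a connected member lies inside one
  component, so choosing a member for each component is injective.\<close>

lemma components_le_cover:
  assumes "finite \<C>" and "card \<C> \<le> n" and "\<And>C. C \<in> \<C> \<Longrightarrow> connected C" and "\<Union>\<C> = S"
  shows "components_le S n"
proof -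
  have "\<exists>C\<in>\<C>. C \<inter> K \<noteq> {}" if "K \<in> components S" for K
    using in_components_nonempty[OF that] in_components_subset[OF that] assms(4) by blast
  then obtain f where f: "\<And>K. K \<in> components S \<Longrightarrow> f K \<in> \<C> \<and> f K \<inter> K \<noteq> {}"
    by metis
  have "inj_on f (components S)"
  proof
    fix K L assume KL: "K \<in> components S" "L \<in> components S" and eq: "f K = f L"
    have "f K \<subseteq> S" "connected (f K)"
      using f[OF KL(1)] assms by auto
    then have "f K \<subseteq> K" "f K \<subseteq> L"
      using components_maximal[of K S "f K"] components_maximal[of L S "f K"] KL f[of K] f[of L] eq
      by auto
    then have "K \<inter> L \<noteq> {}" using f[OF KL(1)] by blast
    then show "K = L" using components_eq KL by blast
  qed
  moreover have "f ` components S \<subseteq> \<C>" using f by blast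
  ultimately show ?thesis
    unfolding components_le_def using assms(1,2)
    by (meson card_inj_on_le finite_subset finite_imageD le_trans)
qed

lemma components_le_continuous_image:
  assumes "components_le S n" and "continuous_on S f"
  shows "components_le (f ` S) n"
proof (rule components_le_cover)
  let ?\<C> = "(`) f ` components S"
  show "finite ?\<C>" "card ?\<C> \<le> n"
    using assms(1) card_image_le[of "components S" "(`) f"] by (auto simp: components_le_def)
  show "connected C" if "C \<in> ?\<C>" for C
  proof -
    obtain K where K: "K \<in> components S" "C = f ` K" using \<open>C \<in> ?\<C>\<close> by blast
    then have "continuous_on K f"
      using assms(2) in_components_subset continuous_on_subset by blast
    then show ?thesis
      using K in_components_connected connected_continuous_image by blast
  qed
  show "\<Union>?\<C> = f ` S"
    using Union_components[of S] by blast
qed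

lemma components_le_connected: "connected S \<Longrightarrow> components_le S 1"
  by (rule components_le_cover[of "{S}"]) auto

text \<open>Only the component \<open>K\<close> containing \<open>D\<close> is lost. A component of
  \<open>U - D\<close> that meets \<open>N\<close> meets \<open>A\<close> or \<open>B\<close>, each
  of which lies in a single component, so at most two arise near \<open>D\<close>; all others were
  components of \<open>U\<close> already.\<close>

lemma components_le_Diff_connected:
  assumes lc: "locally connected X"
    and U: "openin (top_of_set X) U" and UD: "openin (top_of_set X) (U - D)"
    and D: "connected D" "D \<noteq> {}"
    and N: "openin (top_of_set X) N" "D \<subseteq> N" "N \<subseteq> U" "N - D = A \<union> B"
    and AB: "connected A" "connected B"
    and n: "components_le U n"
  shows "components_le (U - D) (n + 1)"
proof -
  have lcUD: "locally connected (U - D)" and lcU: "locally connected U"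
    using locally_open_subset[OF lc] UD U by auto
  have "D \<subseteq> U" using N by auto
  then obtain K where K: "K \<in> components U" "D \<subseteq> K"
    using exists_component_superset[of D U] D by auto
  define P where "P = (\<lambda>A. {C \<in> components (U - D). C \<inter> A \<noteq> {}})"
  have P: "finite (P A) \<and> card (P A) \<le> 1" if "connected A" "A \<subseteq> U - D" for A
  proof -
    have "C = C'" if "C \<in> P A" "C' \<in> P A" for C C'
    proof -
      have "A \<subseteq> C" "A \<subseteq> C'" "C \<inter> A \<noteq> {}"
        using that \<open>connected A\<close> \<open>A \<subseteq> U - D\<close> components_maximal[of _ "U - D" A] by (auto simp: P_def)
      then show ?thesis
        using that components_eq[of C "U - D" C'] by (auto simp: P_def)
    qed
    then have "P A \<subseteq> {SOME C. C \<in> P A}" by (metis (mono_tags, lifting) singleton_iff some_eq_ex subsetI)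
    then show ?thesis
      by (metis card.empty card_insert_le_m1 card_mono finite.emptyI finite.insertI finite_subset
          is_singletonI is_singleton_altdef)
  qed
  have "components (U - D) \<subseteq> (components U - {K}) \<union> (P A \<union> P B)"
  proof
    fix C assume C: "C \<in> components (U - D)"
    have CUD: "C \<subseteq> U - D" "C \<noteq> {}" "connected C"
      using C in_components_subset in_components_nonempty in_components_connected by blast+
    show "C \<in> (components U - {K}) \<union> (P A \<union> P B)"
    proof (cases "C \<inter> N = {}")
      case False
      then have "C \<inter> (A \<union> B) \<noteq> {}" using CUD N(4) by blast
      then show ?thesis using C by (auto simp: P_def)
    next
      \<comment> \<open>Missing \<open>N\<close>, the component \<open>C\<close> keeps away from
        \<open>D\<close> and is clopen in \<open>U\<close>: open by local connectedness, closed
        because \<open>U - C\<close> is the union of the open sets \<open>U - D - C\<close> and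
        \<open>N\<close>.\<close>
      case True
      have "openin (top_of_set (U - D)) C"
        using openin_components_locally_connected[OF lcUD C] .
      then have "openin (top_of_set X) C" using UD openin_trans by blast
      then have opC: "openin (top_of_set U) C"
        using CUD U by (meson Diff_subset openin_imp_subset openin_subset_trans order_trans)
      have cl: "closedin (top_of_set (U - D)) C" using C closedin_component by blast
      have "openin (top_of_set (U - D)) (U - D - C)"
        using openin_diff[OF openin_subtopology_self cl] by simp
      then have "openin (top_of_set X) (U - D - C)" using UD openin_trans by blast
      then have "openin (top_of_set X) ((U - D - C) \<union> N)" using N by blast
      moreover have "(U - D - C) \<union> N = U - C" using True N \<open>D \<subseteq> U\<close> CUD by blast
      ultimately have "openin (top_of_set X) (U - C)" by simp
      then have "openin (top_of_set U) (U - C)"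
        using U by (meson Diff_subset openin_imp_subset openin_subset_trans)
      then have "closedin (top_of_set U) C"
        using CUD by (simp add: closedin_def Diff_Diff_Int) blast
      then have clo: "C' \<inter> C = {} \<or> C' \<subseteq> C" if "connected C'" "C' \<subseteq> U" for C'
      proof -
        have "openin (top_of_set C') (C' \<inter> C)" "closedin (top_of_set C') (C' \<inter> C)"
          using opC \<open>closedin (top_of_set U) C\<close> that(2)
          by (metis inf_commute openin_Int_open openin_open closedin_closed inf.absorb_iff1 inf_assoc)+
        then show ?thesis using that(1) connected_clopen by blast
      qed
      have "C \<in> components U"
        unfolding in_components_maximal using CUD clo by blast
      moreover have "C \<noteq> K" using CUD K D by blast
      ultimately show ?thesis by blast
    qed
  qed
  moreover have "A \<subseteq> U - D" "B \<subseteq> U - D" using N by blast+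
  then have "finite (P A \<union> P B)" "card (P A \<union> P B) \<le> 2"
    using P[OF AB(1)] P[OF AB(2)] card_Un_le[of "P A" "P B"] by auto
  \<comment> \<open>\<open>K\<close> itself witnesses \<open>n \<ge> 1\<close>, so the truncated
    \<open>n - 1\<close> is genuine and \<open>(n - 1) + 2\<close> gives
    \<open>n + 1\<close>.\<close>
  moreover have "card (components U) > 0"
    using n K(1) by (auto simp: components_le_def card_gt_0_iff)
  then have "finite (components U - {K})" "card (components U - {K}) \<le> n - 1" "n \<ge> 1"
    using n K(1) by (auto simp: components_le_def)
  ultimately have "finite (components (U - D))"
    and "card (components (U - D)) \<le> card ((components U - {K}) \<union> (P A \<union> P B))"
    using finite_subset card_mono by (meson finite_UnI)+
  moreover have "card ((components U - {K}) \<union> (P A \<union> P B)) \<le> n + 1"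
    using card_Un_le[of "components U - {K}" "P A \<union> P B"] \<open>card (P A \<union> P B) \<le> 2\<close>
      \<open>card (components U - {K}) \<le> n - 1\<close> \<open>n \<ge> 1\<close> by linarith
  ultimately show ?thesis
    unfolding components_le_def by linarith
qed

text \<open>\<open>A\<close> and \<open>B\<close> may coincide, so that a single point of the 2-sphere is collared as well.\<close>

definition collared :: "'a::metric_space set \<Rightarrow> 'a set \<Rightarrow> bool" where
  "collared X W \<longleftrightarrow> closedin (top_of_set X) W \<and>
    (\<forall>U D. openin (top_of_set X) U \<longrightarrow> openin (top_of_set W) D \<longrightarrow> D \<subseteq> U \<longrightarrow> connected D \<longrightarrow>
      (\<exists>N A B. openin (top_of_set X) N \<and> D \<subseteq> N \<and> N \<subseteq> U \<and> N - D = A \<union> B \<and>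
        connected A \<and> connected B))"

text \<open>The components of \<open>W \<inter> U\<close> are removed one at a time, each at the
  price of one new component.\<close>

lemma components_le_Diff_collared:
  assumes lc: "locally connected X" and U: "openin (top_of_set X) U"
    and W: "collared X W" and n: "components_le U n" and k: "components_le (W \<inter> U) k"
  shows "components_le (U - W) (n + k)"
proof -
  let ?D = "components (W \<inter> U)"
  have fin: "finite ?D" and card: "card ?D \<le> k" using k by (auto simp: components_le_def)
  have clW: "closedin (top_of_set X) W" using W by (simp add: collared_def)
  have WX: "W \<subseteq> X" using clW closedin_imp_subset by blast
  have opWU: "openin (top_of_set W) (W \<inter> U)"
    using U WX by (auto simp: openin_open)
  have clWU: "closedin (top_of_set U) (W \<inter> U)"
    using clW openin_imp_subset[OF U] by (auto simp: closedin_closed)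
  \<comment> \<open>A finite union of components is closed, so every intermediate stage is again
    open in \<open>X\<close> and can play the role of \<open>U\<close> in
    \<open>collared\<close>.\<close>
  have opU: "openin (top_of_set X) (U - \<Union>\<D>)" if "\<D> \<subseteq> ?D" for \<D>
  proof -
    have "finite \<D>" using fin that finite_subset by blast
    then have "closedin (top_of_set (W \<inter> U)) (\<Union>\<D>)"
      using that closedin_component by (intro closedin_Union) blast+
    then have "closedin (top_of_set U) (\<Union>\<D>)" using clWU closedin_trans by blast
    then have "openin (top_of_set U) (U - \<Union>\<D>)"
      using openin_diff[OF openin_subtopology_self] by auto
    then show ?thesis using U openin_trans by blast
  qed
  have "components_le (U - \<Union>\<D>) (n + card \<D>)" if "finite \<D>" "\<D> \<subseteq> ?D" for \<D>
    using that
  proof (induction \<D> rule: finite_induct)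
    case empty
    then show ?case using n by simp
  next
    case (insert D \<D>)
    have D: "D \<in> ?D" "\<D> \<subseteq> ?D" using insert.prems by auto
    let ?U = "U - \<Union>\<D>"
    have eq: "U - \<Union>(insert D \<D>) = ?U - D" by blast
    \<comment> \<open>\<open>D\<close> is what remains of \<open>W \<inter> U\<close> after deleting
      the finitely many other components, whose union is closed.\<close>
    have oD: "openin (top_of_set W) D"
    proof -
      have "D = W \<inter> U - \<Union>(?D - {D})"
        using D Union_components[of "W \<inter> U"] components_nonoverlap[of D "W \<inter> U"] by blast
      moreover have "closedin (top_of_set (W \<inter> U)) (\<Union>(?D - {D}))"
        using fin closedin_component by (intro closedin_Union) blast+
      then have "openin (top_of_set (W \<inter> U)) (W \<inter> U - \<Union>(?D - {D}))"
        using openin_diff[OF openin_subtopology_self] by auto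
      ultimately show ?thesis using opWU openin_trans by metis
    qed
    have "D \<subseteq> ?U"
      using D insert.hyps(2) in_components_subset[OF D(1)] components_nonoverlap[of D "W \<inter> U"] by blast
    moreover have "connected D" "D \<noteq> {}" using D in_components_connected in_components_nonempty by blast+
    ultimately obtain N A B where "openin (top_of_set X) N" "D \<subseteq> N" "N \<subseteq> ?U" "N - D = A \<union> B"
        "connected A" "connected B"
      using W[unfolded collared_def] opU[OF D(2)] oD by meson
    then have "components_le (?U - D) (n + card \<D> + 1)"
      using components_le_Diff_connected[OF lc opU[OF D(2)], of D N A B] opU[OF insert.prems]
        insert.IH[OF D(2)] \<open>connected D\<close> \<open>D \<noteq> {}\<close> unfolding eq by blast
    then show ?case using insert.hyps eq by simp
  qed
  from this[OF fin order.refl] have "components_le (U - W) (n + card ?D)"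
    by (simp add: Union_components[symmetric] Diff_Int)
  then show ?thesis using card components_le_mono[OF _ add_left_mono] by blast
qed

text \<open>The distance from \<open>(x, 0)\<close> to the complement of the coordinate image of \<open>U\<close> is a continuous
  thickness for which the two halves of the tube around a connected \<open>D\<close> stay connected, however
  wildly \<open>U\<close> behaves near its boundary.\<close>

lemma collared_of_product:
  fixes X :: "'a::metric_space set" and T :: "real set"
  assumes cl: "closedin (top_of_set X) W" and X': "openin (top_of_set X) X'"
    and hom: "homeomorphism (W \<times> T) X' g f" and T: "open T" "0 \<in> T"
    and g0: "\<And>x. x \<in> W \<Longrightarrow> g (x, 0) = x"
  shows "collared X W"
  unfolding collared_def
proof (intro conjI allI impI cl)
  fix U D
  assume U: "openin (top_of_set X) U" and D: "openin (top_of_set W) D" "D \<subseteq> U" "connected D"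
  have DW: "D \<subseteq> W" using D openin_imp_subset by blast
  have contg: "continuous_on (W \<times> T) g" using hom by (simp add: homeomorphism_def)
  have inj: "inj_on g (W \<times> T)"
    using hom by (metis homeomorphism_def inj_on_inverseI)
  have gim: "g ` (W \<times> T) = X'" using hom by (simp add: homeomorphism_def)
  \<comment> \<open>The cut-off at height 1 makes the complement of \<open>V\<close> nonempty as
    soon as \<open>W\<close> is: \<open>infdist\<close> to the empty set is 0 by convention, which
    would spoil the positivity of \<open>\<epsilon>\<close>.\<close>
  define V where "V = ((W \<times> T) \<inter> g -` (X' \<inter> U)) \<inter> (UNIV \<times> {-1<..<1})"
  have "openin (top_of_set X') (X' \<inter> U)"
    using X' U openin_imp_subset[OF X'] by (auto simp: openin_open)
  then have "openin (top_of_set (W \<times> T)) ((W \<times> T) \<inter> g -` (X' \<inter> U))"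
    using contg gim by (intro continuous_openin_preimage) auto
  moreover have "openin (top_of_set (W \<times> UNIV)) (W \<times> T)"
    using T by (intro openin_Times) auto
  ultimately have "openin (top_of_set (W \<times> UNIV)) ((W \<times> T) \<inter> g -` (X' \<inter> U))"
    using openin_trans by blast
  then have opV: "openin (top_of_set (W \<times> UNIV)) V"
    unfolding V_def by (rule openin_Int_open) (auto intro: open_Times)
  define \<epsilon> where "\<epsilon> x = infdist (x, 0::real) (W \<times> UNIV - V)" for x
  have inV: "(x, t) \<in> V" if "x \<in> W" "\<bar>t\<bar> < \<epsilon> x" for x t
  proof (rule ccontr)
    assume "(x, t) \<notin> V"
    then have "\<epsilon> x \<le> dist (x, 0) (x, t)"
      using that(1) unfolding \<epsilon>_def by (intro infdist_le) auto
    then show False using that(2) by (simp add: dist_Pair_Pair)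
  qed
  have pos: "\<epsilon> x > 0" if "x \<in> D" for x
  proof -
    have "x \<in> W" using that DW by blast
    then have "g (x, 0) \<in> U" using that D(2) g0[of x] by auto
    moreover have "g (x, 0) \<in> X'" using \<open>x \<in> W\<close> T gim by blast
    ultimately have "(x, 0) \<in> V" using T \<open>x \<in> W\<close> by (simp add: V_def)
    then obtain e where e: "e > 0" "ball (x, 0) e \<inter> (W \<times> UNIV) \<subseteq> V"
      using opV by (meson openin_contains_ball)
    have "(x, 1) \<in> W \<times> UNIV - V" using that DW by (auto simp: V_def)
    then have ne: "W \<times> UNIV - V \<noteq> {}" by blast
    have "e \<le> \<epsilon> x"
      unfolding \<epsilon>_def infdist_notempty[OF ne]
    proof (rule cINF_greatest[OF ne])
      fix z assume "z \<in> W \<times> UNIV - V"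
      then have "z \<notin> ball (x, 0) e" using e by blast
      then show "e \<le> dist (x, 0) z" by simp
    qed
    then show ?thesis using e by simp
  qed
  define M where "M = {z \<in> D \<times> T. \<bar>snd z\<bar> < \<epsilon> (fst z)}"
  \<comment> \<open>Measuring height in units of \<open>\<epsilon> x\<close> makes each half of the
    tube a continuous image of the connected product \<open>D \<times> {0<..<1}\<close>;
    \<open>s\<close> is 1 or -1 and selects the side.\<close>
  define P where "P s = (\<lambda>(x, t). g (x, s * (t * \<epsilon> x))) ` (D \<times> {0<..<1})" for s
  have MV: "M \<subseteq> V" using inV DW by (auto simp: M_def)
  have opM: "openin (top_of_set (W \<times> T)) M"
  proof -
    have "M = (D \<times> T) \<inter> (\<lambda>z. \<epsilon> (fst z) - \<bar>snd z\<bar>) -` {0<..}"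
      by (auto simp: M_def)
    moreover have "continuous_on (D \<times> T) (\<lambda>z. \<epsilon> (fst z) - \<bar>snd z\<bar>)"
      unfolding \<epsilon>_def by (intro continuous_intros)
    ultimately have "openin (top_of_set (D \<times> T)) M"
      by (simp add: continuous_openin_preimage_gen)
    moreover have "openin (top_of_set (W \<times> T)) (D \<times> T)"
      using D by (intro openin_Times) auto
    ultimately show ?thesis using openin_trans by blast
  qed
  have small: "\<bar>s * (t * \<epsilon> x)\<bar> < \<epsilon> x" if "x \<in> D" "0 < t" "t < 1" "\<bar>s\<bar> = 1" for x s t
    using that pos[of x] by (simp add: abs_mult)
  have scaled: "(x, s * (t * \<epsilon> x)) \<in> M" if "x \<in> D" "0 < t" "t < 1" "\<bar>s\<bar> = 1" for x s t
    using small[OF that] inV[of x "s * (t * \<epsilon> x)"] that DW by (auto simp: M_def V_def)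
  have connP: "connected (P s)" if "\<bar>s\<bar> = 1" for s
    unfolding P_def
  proof (rule connected_continuous_image)
    show "connected (D \<times> {0<..<1::real})" using D by (intro connected_Times) auto
    have "continuous_on (D \<times> {0<..<1}) (\<lambda>z. g (fst z, s * (snd z * \<epsilon> (fst z))))"
    proof (rule continuous_on_compose2[OF contg])
      show "continuous_on (D \<times> {0<..<1}) (\<lambda>z. (fst z, s * (snd z * \<epsilon> (fst z))))"
        unfolding \<epsilon>_def by (intro continuous_intros)
      show "(\<lambda>z. (fst z, s * (snd z * \<epsilon> (fst z)))) ` (D \<times> {0<..<1}) \<subseteq> W \<times> T"
        using scaled that DW by (fastforce simp: M_def)
    qed
    then show "continuous_on (D \<times> {0<..<1}) (\<lambda>(x, t). g (x, s * (t * \<epsilon> x)))"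
      by (simp add: case_prod_unfold)
  qed
  have MWT: "M \<subseteq> W \<times> T" using DW by (auto simp: M_def)
  have D0: "(x, 0) \<in> M" if "x \<in> D" for x using that T pos by (simp add: M_def)
  have split: "g ` M - D = P 1 \<union> P (-1)"
  proof
    show "g ` M - D \<subseteq> P 1 \<union> P (-1)"
    proof
      fix y assume y: "y \<in> g ` M - D"
      then obtain x t where xt: "(x, t) \<in> M" "y = g (x, t)" by auto
      then have x: "x \<in> D" "\<bar>t\<bar> < \<epsilon> x" by (auto simp: M_def)
      then have "t \<noteq> 0" using xt y g0 DW by auto
      have "t = sgn t * (\<bar>t\<bar> / \<epsilon> x * \<epsilon> x)"
        using pos[OF x(1)] by (simp add: sgn_if)
      then have "y \<in> P (sgn t)"
        unfolding P_def using xt x pos[OF x(1)] \<open>t \<noteq> 0\<close>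
        by (intro image_eqI[of _ _ "(x, \<bar>t\<bar> / \<epsilon> x)"]) auto
      then show "y \<in> P 1 \<union> P (-1)" using \<open>t \<noteq> 0\<close> by (cases "t > 0") auto
    qed
    have "P s \<subseteq> g ` M - D" if "\<bar>s\<bar> = 1" for s
    proof
      fix y assume "y \<in> P s"
      then obtain x t where xt: "x \<in> D" "0 < t" "t < 1" "y = g (x, s * (t * \<epsilon> x))"
        by (auto simp: P_def)
      note m = scaled[OF xt(1-3) that]
      \<comment> \<open>Points of \<open>D\<close> have height 0 in the product coordinates, and
        \<open>g\<close> is injective, while the height here is nonzero.\<close>
      have "y \<notin> D"
      proof
        assume "y \<in> D"
        then have "y \<in> W" using DW by blast
        then have eq: "g (y, 0) = g (x, s * (t * \<epsilon> x))" using g0 xt(4) by simp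
        have "(y, 0) = (x, s * (t * \<epsilon> x))"
          using inj_onD[OF inj eq] m MWT D0[OF \<open>y \<in> D\<close>] by blast
        then have "s * (t * \<epsilon> x) = 0" by (metis snd_conv)
        then show False using xt pos[of x] that by auto
      qed
      then show "y \<in> g ` M - D" using m xt by auto
    qed
    then show "P 1 \<union> P (-1) \<subseteq> g ` M - D" by auto
  qed
  have "openin (top_of_set X) (g ` M)"
    using homeomorphism_imp_open_map[OF hom opM] X' openin_trans by blast
  moreover have "D \<subseteq> g ` M"
    using D0 g0 DW by (metis image_eqI subset_eq)
  moreover have "g ` M \<subseteq> U" using MV by (auto simp: V_def)
  ultimately show "\<exists>N A B. openin (top_of_set X) N \<and> D \<subseteq> N \<and> N \<subseteq> U \<and> N - D = A \<union> B \<and>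
      connected A \<and> connected B"
    using split connP[of 1] connP[of "-1"]
    by (intro exI[of _ "g ` M"] exI[of _ "P 1"] exI[of _ "P (-1)"] conjI) simp_all
qed

subsection \<open>Circles cut by planes\<close>

lemma components_le_Un:
  assumes "components_le S n" and "components_le T k"
  shows "components_le (S \<union> T) (n + k)"
proof (rule components_le_cover)
  let ?\<C> = "components S \<union> components T"
  show "finite ?\<C>" "card ?\<C> \<le> n + k"
    using assms card_Un_le[of "components S" "components T"] by (auto simp: components_le_def)
  show "\<Union>?\<C> = S \<union> T"
    using Union_components[of S] Union_components[of T] by auto
qed (auto simp: in_components_connected)

text \<open>Removing the largest point \<open>x\<close> of the set splits off one interval on its
  right that contains no other removed point. The \<open>min\<close> and \<open>max\<close> absorb
  the cases in which \<open>x\<close> lies outside the interval.\<close>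

lemma components_le_interval_Diff_finite:
  fixes a b :: real
  assumes "finite F"
  shows "components_le ({a<..<b} - F) (card F + 1)"
  using assms
proof (induction F arbitrary: a b rule: finite_linorder_max_induct)
  case empty
  then show ?case using components_le_connected[of "{a<..<b}"] by simp
next
  case (insert x F)
  have "{a<..<b} - insert x F = ({a<..<min x b} - F) \<union> {max a x<..<b}"
    using insert.hyps by force
  moreover have "components_le (({a<..<min x b} - F) \<union> {max a x<..<b}) ((card F + 1) + 1)"
    using insert.IH by (intro components_le_Un components_le_connected) auto
  ultimately show ?case using insert.hyps by (metis Suc_eq_plus1 card_insert_disjoint less_irrefl)
qed

text \<open>Circles enter as the case of orthogonal \<open>a\<close> and \<open>b\<close> of equal
  length. The parameter runs over all reals, so the range is the full closed curve.\<close>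

definition ellipse :: "'a::real_inner \<Rightarrow> 'a \<Rightarrow> 'a \<Rightarrow> real \<Rightarrow> 'a" where
  "ellipse q a b t = q + cos t *\<^sub>R a + sin t *\<^sub>R b"

text \<open>Along the curve the plane equation reads
  \<open>\<alpha> * cos t + \<beta> * sin t = \<delta>\<close>. If both coefficients vanish, it
  holds everywhere or nowhere; otherwise it prescribes one coordinate of a rotated and scaled unit
  vector, leaving two values for the other.\<close>

lemma range_ellipse_subset_or_finite:
  "range (ellipse q a b) \<subseteq> {x. m \<bullet> x = d} \<or>
    finite (range (ellipse q a b) \<inter> {x. m \<bullet> x = d}) \<and>
    card (range (ellipse q a b) \<inter> {x. m \<bullet> x = d}) \<le> 2"
    (is "?R \<subseteq> ?P \<or> _")
proof -
  define \<alpha> \<beta> \<delta> N where "\<alpha> = m \<bullet> a" "\<beta> = m \<bullet> b" "\<delta> = d - m \<bullet> q" "N = \<alpha>\<^sup>2 + \<beta>\<^sup>2"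
  note defs = this
  have plane: "ellipse q a b t \<in> ?P \<longleftrightarrow> \<alpha> * cos t + \<beta> * sin t = \<delta>" for t
    by (auto simp: ellipse_def defs inner_add_right algebra_simps)
  show ?thesis
  proof (cases "\<alpha> = 0 \<and> \<beta> = 0")
    case True
    then have "?R \<subseteq> ?P \<or> ?R \<inter> ?P = {}" using plane by auto
    then show ?thesis by (auto simp: Int_commute)
  next
    case False
    then have N: "N > 0" by (auto simp: defs sum_power2_gt_zero_iff)
    define s where "s = sqrt (N - \<delta>\<^sup>2)"
    define G where "G z = q + ((\<alpha> * \<delta> - \<beta> * z) / N) *\<^sub>R a + ((\<beta> * \<delta> + \<alpha> * z) / N) *\<^sub>R b" for z
    have "?R \<inter> ?P \<subseteq> {G s, G (-s)}"
    proof
      fix y assume "y \<in> ?R \<inter> ?P"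
      then obtain t where y: "y = ellipse q a b t" and t: "\<alpha> * cos t + \<beta> * sin t = \<delta>"
        using plane by auto
      \<comment> \<open>The pair \<open>(\<delta>, z)\<close> is \<open>(cos t, sin t)\<close>
        rotated and stretched by the root of \<open>N\<close>. Hence \<open>z\<close> is known up to
        sign, and inverting the rotation recovers the point as \<open>G z\<close>.\<close>
      define z where "z = \<alpha> * sin t - \<beta> * cos t"
      have sc: "(sin t)\<^sup>2 + (cos t)\<^sup>2 = 1" by simp
      have "\<alpha> * \<delta> - \<beta> * z = N * cos t" "\<beta> * \<delta> + \<alpha> * z = N * sin t"
        unfolding t[symmetric] z_def defs(4) by (simp_all add: algebra_simps power2_eq_square)
      then have "y = G z" using N by (simp add: y ellipse_def G_def)
      moreover have "z\<^sup>2 = N - \<delta>\<^sup>2"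
        unfolding t[symmetric] z_def defs(4) using sc by algebra
      then have "z = s \<or> z = - s"
        unfolding s_def by (metis real_sqrt_abs abs_eq_iff abs_idempotent)
      ultimately show "y \<in> {G s, G (-s)}" by auto
    qed
    moreover have "card {G s, G (-s)} \<le> 2" by (simp add: card_insert_if)
    ultimately show ?thesis
      by (meson card_mono finite.emptyI finite_insert finite_subset le_trans)
  qed
qed

lemma continuous_on_ellipse [continuous_intros]: "continuous_on S (ellipse q a b)"
  unfolding ellipse_def by (intro continuous_intros)

lemma ellipse_inj:
  assumes "a \<noteq> 0" "b \<noteq> 0" "a \<bullet> b = 0" and eq: "ellipse q a b s = ellipse q a b t"
    and st: "\<bar>s - t\<bar> < 2 * pi"
  shows "s = t"
proof -
  have "(cos s - cos t) *\<^sub>R a + (sin s - sin t) *\<^sub>R b = 0"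
    using eq by (simp add: ellipse_def algebra_simps)
  then have "((cos s - cos t) *\<^sub>R a + (sin s - sin t) *\<^sub>R b) \<bullet> a = 0"
    "((cos s - cos t) *\<^sub>R a + (sin s - sin t) *\<^sub>R b) \<bullet> b = 0" by simp_all
  then have "sin s = sin t \<and> cos s = cos t"
    using assms(1-3) by (simp add: inner_add_left inner_commute[of b a])
  then obtain n :: int where n: "s = t + 2 * pi * n"
    using sin_cos_eq_iff by blast
  then have "2 * pi * \<bar>real_of_int n\<bar> < 2 * pi * 1" using st by (simp add: abs_mult)
  then have "\<bar>real_of_int n\<bar> < 1" by (simp only: mult_less_cancel_left_pos pi_gt_zero zero_less_mult_iff zero_less_numeral simp_thms)
  then have "n = 0" by linarith
  then show ?thesis using n by simp
qed

lemma ellipse_angle: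
  "\<exists>t. t0 \<le> t \<and> t < t0 + 2 * pi \<and> ellipse q a b s = ellipse q a b t"
proof -
  define k where "k = \<lfloor>(s - t0) / (2 * pi)\<rfloor>"
  define t where "t = s - 2 * pi * k"
  have "of_int k \<le> (s - t0) / (2 * pi)" "(s - t0) / (2 * pi) < of_int k + 1"
    unfolding k_def by linarith+
  then have "t0 \<le> t" "t < t0 + 2 * pi" by (simp_all add: t_def field_simps)
  moreover have "sin s = sin t \<and> cos s = cos t"
    unfolding sin_cos_eq_iff by (rule exI[of _ k]) (simp add: t_def)
  ultimately show ?thesis by (auto simp: ellipse_def)
qed

text \<open>Cutting the closed curve at one removed point unrolls it to an open interval of length
  \<open>2 * pi\<close>, on which the remaining removed points are counted. The \<open>max 1\<close>
  covers the uncut curve.\<close>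

lemma components_le_ellipse_Diff_finite:
  assumes ab: "a \<noteq> 0" "b \<noteq> 0" "a \<bullet> b = 0" and P: "finite P" "P \<subseteq> range (ellipse q a b)"
  shows "components_le (range (ellipse q a b) - P) (max 1 (card P))"
proof (cases "P = {}")
  case True
  have "connected (range (ellipse q a b))"
    by (intro connected_continuous_image continuous_intros) auto
  then show ?thesis using True components_le_connected by simp
next
  case False
  let ?E = "ellipse q a b"
  obtain t0 where t0: "?E t0 \<in> P" using False P by blast
  \<comment> \<open>\<open>F\<close> omits \<open>t0\<close>, so \<open>insert t0 F\<close> injects
    into \<open>P\<close>; this gains back the \<open>+ 1\<close> of the interval count.\<close>
  define F where "F = {t \<in> {t0<..<t0 + 2 * pi}. ?E t \<in> P}"
  have "?E ` insert t0 F \<subseteq> P" using t0 by (auto simp: F_def)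
  moreover have inj: "inj_on ?E (insert t0 F)"
    by (rule inj_onI, rule ellipse_inj[OF ab]) (auto simp: F_def)
  ultimately have "finite (insert t0 F)" "card (insert t0 F) \<le> card P"
    using P(1) by (meson inj_on_finite, meson card_inj_on_le)
  then have F: "finite F" "card F + 1 \<le> card P" by (auto simp: F_def)
  have "range ?E - P = ?E ` ({t0<..<t0 + 2 * pi} - F)"
  proof
    show "range ?E - P \<subseteq> ?E ` ({t0<..<t0 + 2 * pi} - F)"
    proof
      fix y assume y: "y \<in> range ?E - P"
      then obtain s where "y = ?E s" by blast
      then obtain t where t: "t0 \<le> t" "t < t0 + 2 * pi" "y = ?E t"
        using ellipse_angle by metis
      then have "t \<noteq> t0" using y t0 by auto
      then show "y \<in> ?E ` ({t0<..<t0 + 2 * pi} - F)"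
        using t y by (intro image_eqI[of _ _ t]) (auto simp: F_def)
    qed
    show "?E ` ({t0<..<t0 + 2 * pi} - F) \<subseteq> range ?E - P" by (auto simp: F_def)
  qed
  moreover have "components_le (?E ` ({t0<..<t0 + 2 * pi} - F)) (card F + 1)"
    by (intro components_le_continuous_image components_le_interval_Diff_finite F continuous_intros)
  ultimately show ?thesis using F(2) components_le_mono by (metis max.coboundedI2)
qed

text \<open>A plane containing the curve deletes it altogether; otherwise each plane contributes at
  most two cut points.\<close>

lemma components_le_ellipse_Diff_planes:
  fixes k :: nat
  assumes ab: "a \<noteq> 0" "b \<noteq> 0" "a \<bullet> b = 0"
  shows "components_le (range (ellipse q a b) - (\<Union>i<k. {x. m i \<bullet> x = d i})) (max 1 (2 * k))"
proof (cases "\<exists>i<k. range (ellipse q a b) \<subseteq> {x. m i \<bullet> x = d i}")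
  case True
  then have "range (ellipse q a b) - (\<Union>i<k. {x. m i \<bullet> x = d i}) = {}" by blast
  then show ?thesis by (metis components_le_empty)
next
  case False
  let ?P = "\<lambda>i. range (ellipse q a b) \<inter> {x. m i \<bullet> x = d i}"
  have P: "finite (?P i)" "card (?P i) \<le> 2" if "i < k" for i
    using range_ellipse_subset_or_finite[of q a b "m i" "d i"] False that by auto
  have "card (\<Union>i<k. ?P i) \<le> (\<Sum>i<k. card (?P i))" by (rule card_UN_le) simp
  also have "\<dots> \<le> (\<Sum>i<k. 2)" using P by (intro sum_mono) auto
  finally have card: "card (\<Union>i<k. ?P i) \<le> 2 * k" by simp
  have "components_le (range (ellipse q a b) - (\<Union>i<k. ?P i)) (max 1 (card (\<Union>i<k. ?P i)))"
    using P(1) by (intro components_le_ellipse_Diff_finite ab finite_UN_I) auto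
  then have "components_le (range (ellipse q a b) - (\<Union>i<k. ?P i)) (max 1 (2 * k))"
    by (rule components_le_mono) (use card in simp)
  moreover have "range (ellipse q a b) - (\<Union>i<k. ?P i) = range (ellipse q a b) - (\<Union>i<k. {x. m i \<bullet> x = d i})"
    by blast
  ultimately show ?thesis by (simp only:)
qed

subsection \<open>Summing up the bounds\<close>

text \<open>The closed form starts at \<open>k = 1\<close>: for \<open>k = 0\<close> the left side
  is 1, the right side 2.\<close>

lemma sum_arcs: "k \<ge> 1 \<Longrightarrow> 1 + (\<Sum>i<k. max 1 (2 * i)) = k * (k - 1) + (2::nat)"
  by (induction k rule: nat_induct_at_least) (auto simp: algebra_simps max_def)

lemma sum_regions:
  "m \<ge> 1 \<Longrightarrow> real (1 + (\<Sum>k<m. 1 + (\<Sum>i<k. max 1 (2 * i)))) = real m ^ 3 / 3 - real m ^ 2 + 8 * real m / 3"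
proof (induction m rule: nat_induct_at_least)
  case (Suc m)
  have "real (m * (m - 1) + 2) = real m * (real m - 1) + 2" using Suc.hyps by (simp add: of_nat_diff)
  then show ?case
    using Suc.IH sum_arcs[OF Suc.hyps] by (simp add: power3_eq_cube power2_eq_square field_simps)
qed simp

lemma real_choose_3: "real (m choose 3) = real m * (real m - 1) * (real m - 2) / 6"
proof (induction m)
  case (Suc m)
  have "real (m choose 2) = real m * (real m - 1) / 2"
    by (induction m) (auto simp: numeral_2_eq_2 field_simps)
  then show ?case using Suc by (simp add: numeral_3_eq_3 numeral_2_eq_2 field_simps)
qed simp

subsection \<open>Plane sections of a sphere\<close>

text \<open>An orthogonal transformation carrying the first coordinate axis to \<open>n\<close>
  carries the other two to \<open>u\<close> and \<open>v\<close>, and the coordinate expansion along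
  with them.\<close>

lemma orthonormal_frame:
  fixes n :: "real ^ 3"
  assumes "norm n = 1"
  obtains u v where "norm u = 1" "norm v = 1" "u \<bullet> v = 0" "n \<bullet> u = 0" "n \<bullet> v = 0"
    "\<And>x. x = (n \<bullet> x) *\<^sub>R n + (u \<bullet> x) *\<^sub>R u + (v \<bullet> x) *\<^sub>R v"
proof -
  obtain f :: "real ^ 3 \<Rightarrow> real ^ 3" where f: "orthogonal_transformation f" and n: "f (axis 1 1) = n"
    using orthogonal_transformation_exists_1[OF norm_axis_1[of 1] assms] by blast
  define u v where "u = f (axis 2 1)" "v = f (axis 3 1)"
  have [simp]: "f x \<bullet> f y = x \<bullet> y" for x y using f by (simp add: orthogonal_transformation_def)
  note [simp] = orthogonal_transformation_norm[OF f]
  have lin: "linear f" using f by (rule orthogonal_transformation_linear)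
  have "x = (n \<bullet> x) *\<^sub>R n + (u \<bullet> x) *\<^sub>R u + (v \<bullet> x) *\<^sub>R v" for x
  proof -
    obtain y where y: "x = f y"
      using orthogonal_transformation_surj[OF f] by (metis surjD)
    have "y = (y $ 1) *\<^sub>R axis 1 1 + (y $ 2) *\<^sub>R axis 2 1 + (y $ 3) *\<^sub>R axis 3 1"
      by (simp add: vec_eq_iff forall_3 axis_def)
    then have "f y = (y $ 1) *\<^sub>R n + (y $ 2) *\<^sub>R u + (y $ 3) *\<^sub>R v"
      unfolding n[symmetric] u_v_def by (metis linear_add[OF lin] linear_scale[OF lin])
    moreover have "n \<bullet> x = y $ 1" "u \<bullet> x = y $ 2" "v \<bullet> x = y $ 3"
      by (simp_all add: y n[symmetric] u_v_def inner_axis')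
    ultimately show ?thesis by (simp only: y)
  qed
  then show thesis
    by (intro that[of u v]) (auto simp: u_v_def n[symmetric] norm_axis_1 inner_axis_axis)
qed

text \<open>This is Pythagoras in the coordinates used for all plane sections: height
  \<open>h\<close> along \<open>n\<close> and horizontal part \<open>w\<close>.\<close>

lemma sphere_slice:
  fixes c n w :: "'a::real_inner"
  assumes "norm n = 1" "n \<bullet> w = 0" "r > 0"
  shows "n \<bullet> (c + h *\<^sub>R n + w - c) = h"
    and "c + h *\<^sub>R n + w \<in> sphere c r \<longleftrightarrow> w \<bullet> w = r\<^sup>2 - h\<^sup>2"
proof -
  have nn: "n \<bullet> n = 1" using assms by (simp add: norm_eq_1)
  show "n \<bullet> (c + h *\<^sub>R n + w - c) = h"
    using nn assms by (simp add: inner_diff_right inner_add_right)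
  have "c + h *\<^sub>R n + w \<in> sphere c r \<longleftrightarrow> norm (h *\<^sub>R n + w) = r"
    by (metis (no_types, lifting) add.assoc add_diff_cancel_left' dist_commute dist_norm mem_sphere)
  also have "\<dots> \<longleftrightarrow> (norm (h *\<^sub>R n + w))\<^sup>2 = r\<^sup>2"
    using assms(3) by (simp add: power2_eq_iff_nonneg)
  also have "(norm (h *\<^sub>R n + w))\<^sup>2 = h\<^sup>2 + w \<bullet> w"
    using nn assms(2) inner_commute[of w n]
    unfolding power2_norm_eq_inner
    by (simp add: inner_add_left inner_add_right power2_eq_square[of h])
  finally show "c + h *\<^sub>R n + w \<in> sphere c r \<longleftrightarrow> w \<bullet> w = r\<^sup>2 - h\<^sup>2" by auto
qed

lemma sphere_slice_obtain:
  fixes c n x :: "'a::real_inner"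
  assumes "norm n = 1" "r > 0" "x \<in> sphere c r" "n \<bullet> (x - c) = h"
  obtains w where "x = c + h *\<^sub>R n + w" "n \<bullet> w = 0" "w \<bullet> w = r\<^sup>2 - h\<^sup>2"
proof -
  define w where "w = x - c - h *\<^sub>R n"
  have nn: "n \<bullet> n = 1" using assms by (simp add: norm_eq_1)
  have "n \<bullet> w = 0" using nn assms(4) unfolding w_def by (subst inner_diff_right) simp
  moreover have x: "x = c + h *\<^sub>R n + w" by (simp add: w_def)
  moreover have "w \<bullet> w = r\<^sup>2 - h\<^sup>2"
    using sphere_slice(2)[OF assms(1) \<open>n \<bullet> w = 0\<close> assms(2), of c h] assms(3) x by metis
  ultimately show thesis using that by blast
qed

text \<open>The horizontal part has length \<open>\<rho>\<close> in the plane of \<open>u\<close>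
  and \<open>v\<close>, hence an angle. This brings plane sections of a sphere within reach of the
  arc counts.\<close>

lemma circle_eq_ellipse:
  fixes c n u v :: "real ^ 3"
  assumes n: "norm n = 1" and uv: "norm u = 1" "norm v = 1" "u \<bullet> v = 0" "n \<bullet> u = 0" "n \<bullet> v = 0"
    and frame: "\<And>x. x = (n \<bullet> x) *\<^sub>R n + (u \<bullet> x) *\<^sub>R u + (v \<bullet> x) *\<^sub>R v"
    and h: "\<bar>h\<bar> < r"
  defines "\<rho> \<equiv> sqrt (r\<^sup>2 - h\<^sup>2)"
  shows "{x \<in> sphere c r. n \<bullet> (x - c) = h} = range (ellipse (c + h *\<^sub>R n) (\<rho> *\<^sub>R u) (\<rho> *\<^sub>R v))"
    (is "?C = ?E")
proof -
  have r: "r > 0" using h by linarith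
  have "h\<^sup>2 < r\<^sup>2" using h r abs_le_square_iff[of r h] by linarith
  then have \<rho>: "\<rho> > 0" "\<rho>\<^sup>2 = r\<^sup>2 - h\<^sup>2" by (simp_all add: \<rho>_def)
  have uu: "u \<bullet> u = 1" "v \<bullet> v = 1" "v \<bullet> u = 0" using uv by (auto simp: norm_eq_1 inner_commute)
  show ?thesis
  proof
    show "?C \<subseteq> ?E"
    proof
      fix x assume x: "x \<in> ?C"
      then obtain w where w: "x = c + h *\<^sub>R n + w" "n \<bullet> w = 0" "w \<bullet> w = r\<^sup>2 - h\<^sup>2"
        using sphere_slice_obtain[OF n r, of x c h] by blast
      have wuv: "w = (u \<bullet> w) *\<^sub>R u + (v \<bullet> w) *\<^sub>R v" using frame[of w] w by simp
      have "w \<bullet> w = (u \<bullet> w) * (u \<bullet> w) + (v \<bullet> w) * (v \<bullet> w)"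
        by (subst (2) wuv) (simp add: inner_add_right inner_commute)
      then have "(u \<bullet> w)\<^sup>2 + (v \<bullet> w)\<^sup>2 = \<rho>\<^sup>2"
        using \<rho>(2) w(3) by (simp add: power2_eq_square)
      then have "((u \<bullet> w) / \<rho>)\<^sup>2 + ((v \<bullet> w) / \<rho>)\<^sup>2 = 1"
        using \<rho>(1) unfolding power_divide add_divide_distrib[symmetric] by simp
      then obtain t where "(u \<bullet> w) / \<rho> = cos t" "(v \<bullet> w) / \<rho> = sin t"
        using sincos_total_2pi by metis
      then have "u \<bullet> w = cos t * \<rho>" "v \<bullet> w = sin t * \<rho>" using \<rho> by (simp_all add: field_simps)
      then have "x = ellipse (c + h *\<^sub>R n) (\<rho> *\<^sub>R u) (\<rho> *\<^sub>R v) t"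
        unfolding ellipse_def w(1) by (subst wuv) (simp add: add.assoc)
      then show "x \<in> ?E" by blast
    qed
    show "?E \<subseteq> ?C"
    proof
      fix x assume "x \<in> ?E"
      then obtain t where x: "x = c + h *\<^sub>R n + ((\<rho> * cos t) *\<^sub>R u + (\<rho> * sin t) *\<^sub>R v)"
        by (auto simp: ellipse_def algebra_simps)
      define w where "w = (\<rho> * cos t) *\<^sub>R u + (\<rho> * sin t) *\<^sub>R v"
      have "n \<bullet> w = 0" using uv by (simp add: w_def inner_add_right)
      moreover have "w \<bullet> w = (\<rho> * cos t)\<^sup>2 + (\<rho> * sin t)\<^sup>2"
        unfolding w_def using uu uv by (simp add: inner_add_right inner_add_left power2_eq_square)
      then have "w \<bullet> w = \<rho>\<^sup>2 * ((sin t)\<^sup>2 + (cos t)\<^sup>2)"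
        unfolding power_mult_distrib by (simp only: distrib_left add.commute)
      then have "w \<bullet> w = r\<^sup>2 - h\<^sup>2" using \<rho> by simp
      ultimately show "x \<in> ?C"
        using sphere_slice[OF n, of w r c h] r x unfolding w_def by auto
    qed
  qed
qed

section \<open>Collars of spheres, circles and points\<close>

text \<open>Polar coordinates: space without the centre is the sphere times the radial offset
  \<open>t > - r\<close>.\<close>

lemma collared_sphere:
  fixes c :: "'a::euclidean_space"
  assumes r: "r > 0"
  shows "collared UNIV (sphere c r)"
proof (rule collared_of_product)
  let ?g = "\<lambda>z. c + ((r + snd z) / r) *\<^sub>R (fst z - c)"
  let ?f = "\<lambda>y. (c + (r / norm (y - c)) *\<^sub>R (y - c), norm (y - c) - r)"
  show "closedin (top_of_set UNIV) (sphere c r)" by simp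
  show "openin (top_of_set UNIV) (- {c})" by (simp add: open_Compl)
  show "open {- r<..}" "0 \<in> {- r<..}" using r by auto
  show "?g (x, 0) = x" for x using r by simp
  have dist: "norm (x - c) = r" if "x \<in> sphere c r" for x
    using that by (simp add: dist_norm norm_minus_commute)
  show "homeomorphism (sphere c r \<times> {- r<..}) (- {c}) ?g ?f"
  proof (rule homeomorphismI)
    show "continuous_on (sphere c r \<times> {- r<..}) ?g" using r by (intro continuous_intros) auto
    show "continuous_on (- {c}) ?f" by (intro continuous_intros) auto
    show "?g ` (sphere c r \<times> {- r<..}) \<subseteq> - {c}" using r dist by fastforce
    show "?f ` (- {c}) \<subseteq> sphere c r \<times> {- r<..}" using r by (auto simp: dist_norm)
    show "?f (?g z) = z" if "z \<in> sphere c r \<times> {- r<..}" for z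
    proof -
      obtain x t where z: "z = (x, t)" "norm (x - c) = r" "t > - r"
        using \<open>z \<in> _\<close> dist by (cases z) auto
      then have "norm (((r + t) / r) *\<^sub>R (x - c)) = r + t" using r by simp
      then show ?thesis using z r by simp
    qed
    show "?g (?f y) = y" if "y \<in> - {c}" for y using that r by simp
  qed
qed

text \<open>The sphere without the poles in direction \<open>n\<close> is swept out by moving the
  circle in height and rescaling its horizontal part. \<open>R t\<close> is the radius of the
  parallel at height \<open>t\<close>, and \<open>?T\<close> contains the shifts that stay between
  the poles.\<close>

lemma collared_circle:
  fixes c n :: "'a::euclidean_space"
  assumes n: "norm n = 1" and h: "\<bar>h\<bar> < r"
  shows "collared (sphere c r) {x \<in> sphere c r. n \<bullet> (x - c) = h}"
proof (rule collared_of_product)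
  let ?W = "{x \<in> sphere c r. n \<bullet> (x - c) = h}"
  let ?T = "{- r - h<..<r - h}"
  let ?X = "{y \<in> sphere c r. \<bar>n \<bullet> (y - c)\<bar> < r}"
  define R where "R t = sqrt (r\<^sup>2 - t\<^sup>2)" for t
  define g where "g z = c + (h + snd z) *\<^sub>R n + (R (h + snd z) / R h) *\<^sub>R (fst z - c - h *\<^sub>R n)" for z
  define f where "f y = (c + h *\<^sub>R n + (R h / R (n \<bullet> (y - c))) *\<^sub>R (y - c - (n \<bullet> (y - c)) *\<^sub>R n),
      n \<bullet> (y - c) - h)" for y
  have r: "r > 0" using h by linarith
  have R: "R t > 0" "(R t)\<^sup>2 = r\<^sup>2 - t\<^sup>2" if "\<bar>t\<bar> < r" for t
  proof -
    have "t\<^sup>2 < r\<^sup>2" using that abs_le_square_iff[of r t] r by linarith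
    then show "R t > 0" "(R t)\<^sup>2 = r\<^sup>2 - t\<^sup>2" by (simp_all add: R_def)
  qed
  have contR: "continuous_on S R" for S unfolding R_def by (intro continuous_intros)
  have g: "g (c + h *\<^sub>R n + w, s) = c + (h + s) *\<^sub>R n + (R (h + s) / R h) *\<^sub>R w" for w s
    by (simp add: g_def)
  have f: "f (c + t *\<^sub>R n + w) = (c + h *\<^sub>R n + (R h / R t) *\<^sub>R w, t - h)" if "n \<bullet> w = 0" for w t
    using sphere_slice(1)[OF n that r, of c t] unfolding f_def by simp
  have mem: "c + t *\<^sub>R n + (R t / R t') *\<^sub>R w \<in> sphere c r \<and>
      n \<bullet> (c + t *\<^sub>R n + (R t / R t') *\<^sub>R w - c) = t"
    if w: "n \<bullet> w = 0" "w \<bullet> w = r\<^sup>2 - t'\<^sup>2" and t: "\<bar>t\<bar> < r" "\<bar>t'\<bar> < r" for w t t'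
  proof -
    have "(R t / R t') *\<^sub>R w \<bullet> (R t / R t') *\<^sub>R w = r\<^sup>2 - t\<^sup>2"
    proof -
      have "w \<bullet> w = (R t')\<^sup>2" using w R[OF t(2)] by simp
      then have "(R t / R t') *\<^sub>R w \<bullet> (R t / R t') *\<^sub>R w = (R t)\<^sup>2"
        using R(1)[OF t(2)] by (simp add: power2_eq_square)
      then show ?thesis using R[OF t(1)] by simp
    qed
    moreover have "n \<bullet> (R t / R t') *\<^sub>R w = 0" using w by simp
    ultimately show ?thesis using sphere_slice[OF n _ r] by blast
  qed
  show "closedin (top_of_set (sphere c r)) ?W"
  proof -
    have "?W = sphere c r \<inter> {x. n \<bullet> x = h + n \<bullet> c}" by (auto simp: inner_diff_right)
    then show ?thesis by (metis closed_hyperplane closedin_closed_Int)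
  qed
  show "openin (top_of_set (sphere c r)) ?X"
  proof -
    have "?X = sphere c r \<inter> {y. \<bar>n \<bullet> (y - c)\<bar> < r}" by auto
    moreover have "open {y. \<bar>n \<bullet> (y - c)\<bar> < r}" by (intro open_Collect_less continuous_intros)
    ultimately show ?thesis by (metis openin_open_Int)
  qed
  show "open ?T" "0 \<in> ?T" using h by auto
  show "g (x, 0) = x" if "x \<in> ?W" for x using R[OF h] by (simp add: g_def)
  show "homeomorphism (?W \<times> ?T) ?X g f"
  proof (rule homeomorphismI)
    have W: "\<exists>w. x = c + h *\<^sub>R n + w \<and> n \<bullet> w = 0 \<and> w \<bullet> w = r\<^sup>2 - h\<^sup>2" if "x \<in> ?W" for x
      using sphere_slice_obtain[OF n r, of x c h] that by blast
    show "continuous_on (?W \<times> ?T) g"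
      unfolding g_def using R[OF h] by (intro continuous_intros continuous_on_compose2[OF contR[of UNIV]]) auto
    show "continuous_on ?X f"
      unfolding f_def using R by (intro continuous_intros continuous_on_compose2[OF contR[of UNIV]]) fastforce+
    show "g ` (?W \<times> ?T) \<subseteq> ?X"
    proof
      fix y assume "y \<in> g ` (?W \<times> ?T)"
      then obtain x s where y: "y = g (x, s)" and "x \<in> ?W" "s \<in> ?T" by blast
      then obtain w where w: "x = c + h *\<^sub>R n + w" "n \<bullet> w = 0" "w \<bullet> w = r\<^sup>2 - h\<^sup>2"
        using W by blast
      have hs: "\<bar>h + s\<bar> < r" using \<open>s \<in> ?T\<close> by auto
      show "y \<in> ?X"
        unfolding y w(1) g using mem[OF w(2,3) hs h] hs by simp
    qed
    have X: "\<exists>w t. y = c + t *\<^sub>R n + w \<and> n \<bullet> w = 0 \<and> w \<bullet> w = r\<^sup>2 - t\<^sup>2 \<and> \<bar>t\<bar> < r" if "y \<in> ?X" for y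
      using sphere_slice_obtain[OF n r _ refl, of y c] that by blast
    show "f ` ?X \<subseteq> ?W \<times> ?T"
    proof
      fix z assume "z \<in> f ` ?X"
      then obtain w t where z: "z = f (c + t *\<^sub>R n + w)" "n \<bullet> w = 0" "w \<bullet> w = r\<^sup>2 - t\<^sup>2" "\<bar>t\<bar> < r"
        using X by blast
      then show "z \<in> ?W \<times> ?T"
        using mem[OF z(2,3) h z(4)] f[OF z(2), of t] by auto
    qed
    show "f (g z) = z" if "z \<in> ?W \<times> ?T" for z
    proof -
      obtain x s where zs: "z = (x, s)" "x \<in> ?W" "s \<in> ?T" using \<open>z \<in> ?W \<times> ?T\<close> by blast
      then obtain w where w: "x = c + h *\<^sub>R n + w" "n \<bullet> w = 0" using W by blast
      have "\<bar>h + s\<bar> < r" using \<open>s \<in> ?T\<close> by auto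
      then show ?thesis
        unfolding zs(1) w(1) g using w(2) R(1)[of "h + s"] R(1)[OF h] by (subst f) auto
    qed
    show "g (f y) = y" if "y \<in> ?X" for y
    proof -
      obtain w t where y: "y = c + t *\<^sub>R n + w" "n \<bullet> w = 0" "\<bar>t\<bar> < r"
        using X \<open>y \<in> ?X\<close> by blast
      then show ?thesis
        unfolding y(1) f[OF y(2)] g using R(1)[OF y(3)] R(1)[OF h] by simp
    qed
  qed
qed

text \<open>A point has no product neighbourhood as required for circles, so a small spherical cap
  serves as \<open>N\<close>. Without its apex the cap is connected, and it is taken for both
  \<open>A\<close> and \<open>B\<close>.\<close>

lemma collared_point:
  fixes c n :: "real ^ 3"
  assumes n: "norm n = 1" and r: "r > 0"
  shows "collared (sphere c r) {c + r *\<^sub>R n}"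
  unfolding collared_def
proof (intro conjI allI impI)
  let ?p = "c + r *\<^sub>R n"
  have p: "?p \<in> sphere c r" using n r by (simp add: dist_norm)
  show "closedin (top_of_set (sphere c r)) {?p}"
    using p by (simp add: closed_subset)
  fix U D
  assume U: "openin (top_of_set (sphere c r)) U" and "openin (top_of_set {?p}) D" and DU: "D \<subseteq> U"
  then have "D \<subseteq> {?p}" using openin_imp_subset by blast
  then consider "D = {}" | "D = {?p}" by blast
  then show "\<exists>N A B. openin (top_of_set (sphere c r)) N \<and> D \<subseteq> N \<and> N \<subseteq> U \<and> N - D = A \<union> B \<and>
      connected A \<and> connected B"
  proof cases
    case 1
    then show ?thesis by (intro exI[of _ "{}"]) auto
  next
    case 2
    then obtain e where e: "e > 0" "ball ?p e \<inter> sphere c r \<subseteq> U"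
      using U DU by (meson openin_contains_ball insert_subset)
    \<comment> \<open>A point of the sphere at height \<open>h\<close> has squared distance
      \<open>2 * r * (r - h)\<close> from the apex, so the second bound puts the cap inside the
      ball; \<open>\<delta> \<le> r\<close> keeps the heights positive.\<close>
    define \<delta> where "\<delta> = min r (e\<^sup>2 / (2 * r))"
    have \<delta>: "0 < \<delta>" "\<delta> \<le> r" "2 * r * \<delta> \<le> e\<^sup>2"
      using r e by (auto simp: \<delta>_def min_def field_simps)
    define N where "N = sphere c r \<inter> {y. n \<bullet> (y - c) > r - \<delta>}"
    obtain u v where uv: "norm u = 1" "norm v = 1" "u \<bullet> v = 0" "n \<bullet> u = 0" "n \<bullet> v = 0"
      and frame: "\<And>x. x = (n \<bullet> x) *\<^sub>R n + (u \<bullet> x) *\<^sub>R u + (v \<bullet> x) *\<^sub>R v"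
      using orthonormal_frame[OF n] by metis
    define \<Gamma> where "\<Gamma> h = ellipse (c + h *\<^sub>R n) (sqrt (r\<^sup>2 - h\<^sup>2) *\<^sub>R u) (sqrt (r\<^sup>2 - h\<^sup>2) *\<^sub>R v)" for h
    have \<Gamma>: "{x \<in> sphere c r. n \<bullet> (x - c) = h} = range (\<Gamma> h)" if "\<bar>h\<bar> < r" for h
      unfolding \<Gamma>_def using circle_eq_ellipse[OF n uv frame that] .
    have "open {y. n \<bullet> (y - c) > r - \<delta>}" by (intro open_Collect_less continuous_intros)
    then have opN: "openin (top_of_set (sphere c r)) N" unfolding N_def by (rule openin_open_Int)
    have np: "n \<bullet> (?p - c) = r" using n by (simp add: norm_eq_1)
    have pN: "?p \<in> N" using p np \<delta> by (simp add: N_def)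
    have NU: "N \<subseteq> U"
    proof
      fix y assume y: "y \<in> N"
      have "norm (y - c) = r" using y by (simp add: N_def dist_norm norm_minus_commute)
      then have yy: "(y - c) \<bullet> (y - c) = r\<^sup>2" by (simp add: dot_square_norm)
      have "(norm (y - ?p))\<^sup>2 = (norm ((y - c) - r *\<^sub>R n))\<^sup>2" by (simp add: algebra_simps)
      also have "\<dots> = 2 * r * (r - n \<bullet> (y - c))"
        unfolding power2_norm_eq_inner inner_diff_left[of "y - c"] inner_diff_right[of _ "y - c"]
        using yy n by (simp add: norm_eq_1 power2_eq_square inner_commute[of "y - c" n] right_diff_distrib)
      also have "\<dots> < 2 * r * \<delta>" using y r by (auto simp: N_def)
      finally have "(norm (y - ?p))\<^sup>2 < e\<^sup>2" using \<delta> by linarith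
      then have "norm (y - ?p) < e" using e by (meson less_eq_real_def power2_less_imp_less)
      then have "y \<in> ball ?p e" by (simp only: mem_ball dist_norm norm_minus_commute)
      then show "y \<in> U" using e y by (auto simp: N_def)
    qed
    \<comment> \<open>Height and angle parametrise the punctured cap, which makes it the image of a
      connected strip.\<close>
    let ?I = "{r - \<delta><..<r} \<times> (UNIV :: real set)"
    have "N - {?p} = (\<lambda>z. \<Gamma> (fst z) (snd z)) ` ?I"
    proof
      show "N - {?p} \<subseteq> (\<lambda>z. \<Gamma> (fst z) (snd z)) ` ?I"
      proof
        fix y assume y: "y \<in> N - {?p}"
        define h where "h = n \<bullet> (y - c)"
        have "y \<in> sphere c r" using y by (simp add: N_def)
        then obtain w where w: "y = c + h *\<^sub>R n + w" "w \<bullet> w = r\<^sup>2 - h\<^sup>2"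
          using sphere_slice_obtain[OF n r _ h_def[symmetric]] by blast
        have h: "h > r - \<delta>" using y by (simp add: N_def h_def)
        have "h\<^sup>2 \<le> r\<^sup>2" using w(2) inner_ge_zero[of w] by linarith
        then have "h \<le> r" using r by (meson less_eq_real_def power2_le_imp_le)
        moreover have "h \<noteq> r" using w y by auto
        ultimately have "h < r" by simp
        moreover have "\<bar>h\<bar> < r" using \<open>h < r\<close> h \<delta> by linarith
        moreover have "y \<in> {x \<in> sphere c r. n \<bullet> (x - c) = h}" using y by (simp add: h_def N_def)
        ultimately have "y \<in> range (\<Gamma> h)" using \<Gamma> by blast
        then obtain t where "y = \<Gamma> h t" by blast
        then show "y \<in> (\<lambda>z. \<Gamma> (fst z) (snd z)) ` ?I"
          using h \<open>h < r\<close> by (intro image_eqI[of _ _ "(h, t)"]) auto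
      qed
      show "(\<lambda>z. \<Gamma> (fst z) (snd z)) ` ?I \<subseteq> N - {?p}"
      proof clarify
        fix h t :: real assume h: "h \<in> {r - \<delta><..<r}"
        then have "\<Gamma> h t \<in> {x \<in> sphere c r. n \<bullet> (x - c) = h}" using \<Gamma>[of h] \<delta> by auto
        then have "\<Gamma> h t \<in> sphere c r" "n \<bullet> (\<Gamma> h t - c) = h" by blast+
        moreover from this have "\<Gamma> h t \<noteq> ?p" using np h by (metis greaterThanLessThan_iff less_irrefl)
        ultimately show "\<Gamma> (fst (h, t)) (snd (h, t)) \<in> N - {?p}"
          using h unfolding N_def by (metis DiffI IntI fst_conv greaterThanLessThan_iff mem_Collect_eq singletonD snd_conv)
      qed
    qed
    moreover have "connected ((\<lambda>z. \<Gamma> (fst z) (snd z)) ` ?I)"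
    proof (rule connected_continuous_image)
      show "continuous_on ?I (\<lambda>z. \<Gamma> (fst z) (snd z))"
        unfolding \<Gamma>_def ellipse_def by (intro continuous_intros)
      show "connected ?I" by (intro connected_Times) auto
    qed
    ultimately have "connected (N - {?p})" by simp
    then show ?thesis
      using opN pN NU 2 by (intro exI[of _ N] exI[of _ "N - {?p}"]) auto
  qed
qed

subsection \<open>Counting regions\<close>

text \<open>The normal \<open>m k\<close> may vanish; the ``plane'' is then empty or the whole space, which is what
  concentric and coinciding spheres produce.\<close>

lemma components_le_sphere_Diff_plane:
  fixes c :: "real ^ 3" and m :: "nat \<Rightarrow> real ^ 3"
  assumes r: "r > 0"
    and U: "U = sphere c r - (\<Union>i<k. {x. m i \<bullet> x = d i})" and N: "components_le U N"
  shows "components_le (U - {x. m k \<bullet> x = d k}) (N + max 1 (2 * k))"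
proof -
  define W where "W = sphere c r \<inter> {x. m k \<bullet> x = d k}"
  have UW: "U - {x. m k \<bullet> x = d k} = U - W" using U by (auto simp: W_def)
  have lc: "locally connected (sphere c r)" by (rule locally_connected_sphere)
  have opU: "openin (top_of_set (sphere c r)) U"
  proof -
    have "closed (\<Union>i<k. {x. m i \<bullet> x = d i})" by (intro closed_UN) (auto intro: closed_hyperplane)
    then show ?thesis unfolding U Diff_eq by (intro openin_open_Int) (rule open_Compl)
  qed
  note step = components_le_Diff_collared[OF lc opU _ N, of W "max 1 (2 * k)", folded UW]
  have trivial: ?thesis if "U - W = U \<or> U - W = {}"
    using that N components_le_mono[OF N le_add1] UW by (metis components_le_empty)
  show ?thesis
  proof (cases "m k = 0")
    case True
    then show ?thesis using trivial U by (auto simp: W_def)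
  next
    case False
    \<comment> \<open>\<open>n\<close> is the unit normal of the plane and \<open>h\<close> its
      signed distance from the centre; comparing \<open>\<bar>h\<bar>\<close> with \<open>r\<close>
      separates circle, tangency point and empty section.\<close>
    define n where "n = m k /\<^sub>R norm (m k)"
    define h where "h = (d k - m k \<bullet> c) / norm (m k)"
    have n: "norm n = 1" using False by (simp add: n_def)
    have W: "W = {x \<in> sphere c r. n \<bullet> (x - c) = h}"
      using False by (auto simp: W_def n_def h_def inner_diff_right field_simps)
    consider "\<bar>h\<bar> < r" | "\<bar>h\<bar> = r" | "\<bar>h\<bar> > r" by linarith
    then show ?thesis
    proof cases
      case 1
      obtain u v where uv: "norm u = 1" "norm v = 1" "u \<bullet> v = 0" "n \<bullet> u = 0" "n \<bullet> v = 0"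
        and frame: "\<And>x. x = (n \<bullet> x) *\<^sub>R n + (u \<bullet> x) *\<^sub>R u + (v \<bullet> x) *\<^sub>R v"
        using orthonormal_frame[OF n] by metis
      define \<rho> where "\<rho> = sqrt (r\<^sup>2 - h\<^sup>2)"
      have "h\<^sup>2 < r\<^sup>2" using 1 r abs_le_square_iff[of r h] by linarith
      then have "\<rho> \<noteq> 0" by (simp add: \<rho>_def)
      then have ab: "\<rho> *\<^sub>R u \<noteq> 0" "\<rho> *\<^sub>R v \<noteq> 0" "\<rho> *\<^sub>R u \<bullet> \<rho> *\<^sub>R v = 0" using uv by auto
      have E: "W = range (ellipse (c + h *\<^sub>R n) (\<rho> *\<^sub>R u) (\<rho> *\<^sub>R v))"
        unfolding W \<rho>_def using circle_eq_ellipse[OF n uv frame 1] .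
      have "W \<inter> U = W - (\<Union>i<k. {x. m i \<bullet> x = d i})" using U by (auto simp: W_def)
      then have "components_le (W \<inter> U) (max 1 (2 * k))"
        unfolding E by (simp only: components_le_ellipse_Diff_planes[OF ab])
      then show ?thesis
        using step collared_circle[OF n 1] W by simp
    next
      case 2
      \<comment> \<open>Since \<open>h\<close> is \<open>r\<close> or \<open>- r\<close>, this flips
        the normal if necessary, so that the tangency point lies at height
        \<open>+r\<close>.\<close>
      define n' where "n' = (h / r) *\<^sub>R n"
      have n': "norm n' = 1" using n 2 r by (simp add: n'_def)
      have hr: "h\<^sup>2 = r\<^sup>2" using 2 power2_abs by metis
      have "W = {c + r *\<^sub>R n'}"
      proof (intro equalityI subsetI)
        fix x assume "x \<in> W"
        then obtain w where "x = c + h *\<^sub>R n + w" "w \<bullet> w = r\<^sup>2 - h\<^sup>2"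
          using sphere_slice_obtain[OF n r, of x c h] W by blast
        then show "x \<in> {c + r *\<^sub>R n'}" using hr r by (simp add: n'_def)
      next
        fix x assume "x \<in> {c + r *\<^sub>R n'}"
        then have "x = c + h *\<^sub>R n + 0" using r by (simp add: n'_def)
        then show "x \<in> W"
          unfolding W using sphere_slice[OF n _ r, of 0 c h] hr by auto
      qed
      moreover from this have "components_le (W \<inter> U) (max 1 (2 * k))"
        by (intro components_le_mono[OF components_le_connected]) (auto simp: Int_insert_left)
      ultimately show ?thesis
        using step collared_point[OF n' r, of c] by simp
    next
      case 3
      have "W = {}"
      proof (rule ccontr)
        assume "W \<noteq> {}"
        then obtain x where "x \<in> W" by blast
        then have "x \<in> sphere c r" "n \<bullet> (x - c) = h" unfolding W by blast+
        then obtain w where "x = c + h *\<^sub>R n + w" "n \<bullet> w = 0" "w \<bullet> w = r\<^sup>2 - h\<^sup>2"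
          by (rule sphere_slice_obtain[OF n r])
        then have "h\<^sup>2 \<le> r\<^sup>2" using inner_ge_zero[of w] by linarith
        then show False using 3 r abs_le_square_iff[of h r] by linarith
      qed
      then show ?thesis using trivial by simp
    qed
  qed
qed

text \<open>The leading 1 counts the uncut sphere, which is connected in dimension 3; the summand
  for \<open>i\<close> bounds the arcs of the section by plane \<open>i\<close> after the
  \<open>i\<close> earlier cuts.\<close>

lemma components_le_sphere_Diff_planes:
  fixes c :: "real ^ 3" and m :: "nat \<Rightarrow> real ^ 3"
  assumes r: "r > 0"
  shows "components_le (sphere c r - (\<Union>i<k. {x. m i \<bullet> x = d i})) (1 + (\<Sum>i<k. max 1 (2 * i)))"
proof (induction k)
  case 0
  have "connected (sphere c r)" by (rule connected_sphere) simp
  then show ?case using components_le_connected by simp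
next
  case (Suc k)
  have "sphere c r - (\<Union>i<Suc k. {x. m i \<bullet> x = d i}) =
      sphere c r - (\<Union>i<k. {x. m i \<bullet> x = d i}) - {x. m k \<bullet> x = d k}"
    by (auto simp: lessThan_Suc)
  then show ?case
    using components_le_sphere_Diff_plane[OF r refl Suc.IH] by (simp add: add.assoc)
qed

section \<open>Radical planes and the passage to complements of spheres\<close>

text \<open>Subtracting the two sphere equations cancels the quadratic terms and leaves the radical
  plane. For equal centres the normal is 0, and the equation holds exactly when the radii
  agree.\<close>

lemma sphere_Int_sphere:
  fixes c c' :: "'a::real_inner"
  assumes "r > 0" "r' > 0"
  shows "sphere c r \<inter> sphere c' r' =
    sphere c r \<inter> {x. (c' - c) \<bullet> x = (r\<^sup>2 - r'\<^sup>2 + c' \<bullet> c' - c \<bullet> c) / 2}"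
proof -
  have sph: "x \<in> sphere a s \<longleftrightarrow> x \<bullet> x - 2 * (a \<bullet> x) + a \<bullet> a = s\<^sup>2" if "s > 0" for a x :: 'a and s
  proof -
    have "x \<in> sphere a s \<longleftrightarrow> (norm (x - a))\<^sup>2 = s\<^sup>2"
      using that by (simp add: dist_norm norm_minus_commute power2_eq_iff_nonneg)
    then show ?thesis
      by (simp add: power2_norm_eq_inner inner_diff_left inner_diff_right inner_commute[of x a] algebra_simps)
  qed
  show ?thesis
    using sph[OF assms(1), of _ c] sph[OF assms(2), of _ c']
    by (auto simp: inner_diff_left)
qed

lemma components_le_Compl_spheres:
  fixes c :: "nat \<Rightarrow> real ^ 3"
  assumes "\<And>i. i < m \<Longrightarrow> r i > 0"
  shows "components_le (UNIV - (\<Union>i<m. sphere (c i) (r i)))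
    (1 + (\<Sum>k<m. 1 + (\<Sum>i<k. max 1 (2 * i))))"
  using assms
proof (induction m)
  case 0
  show ?case using components_le_connected[OF connected_UNIV] by simp
next
  case (Suc k)
  let ?U = "UNIV - (\<Union>i<k. sphere (c i) (r i))"
  let ?W = "sphere (c k) (r k)"
  have r: "r k > 0" "\<And>i. i < k \<Longrightarrow> r i > 0" using Suc.prems by auto
  \<comment> \<open>\<open>q i\<close> and \<open>d i\<close> describe the radical plane of the new
    sphere and sphere \<open>i\<close>; the planes change with every new sphere.\<close>
  define q where "q i = c i - c k" for i
  define d where "d i = ((r k)\<^sup>2 - (r i)\<^sup>2 + c i \<bullet> c i - c k \<bullet> c k) / 2" for i
  have "?W \<inter> sphere (c i) (r i) = ?W \<inter> {x. q i \<bullet> x = d i}" if "i < k" for i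
    unfolding q_def d_def using r that by (intro sphere_Int_sphere) auto
  then have "?W \<inter> ?U = ?W - (\<Union>i<k. {x. q i \<bullet> x = d i})" by blast
  then have "components_le (?W \<inter> ?U) (1 + (\<Sum>i<k. max 1 (2 * i)))"
    by (simp only: components_le_sphere_Diff_planes[OF r(1)])
  moreover have "open ?U" by (intro open_Diff closed_UN) auto
  then have "openin (top_of_set UNIV) ?U" by simp
  moreover have "locally connected (UNIV :: (real ^ 3) set)"
    by (simp add: convex_imp_locally_connected)
  \<comment> \<open>In the first sum the bound \<open>k\<close> shadows the fixed one, which is its
    upper limit.\<close>
  ultimately have "components_le (?U - ?W)
      (1 + (\<Sum>k<k. 1 + (\<Sum>i<k. max 1 (2 * i))) + (1 + (\<Sum>i<k. max 1 (2 * i))))"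
    using components_le_Diff_collared collared_sphere[OF r(1)] Suc.IH[OF r(2)] by blast
  moreover have "UNIV - (\<Union>i<Suc k. sphere (c i) (r i)) = ?U - ?W" by (auto simp: lessThan_Suc)
  ultimately show ?case by (simp add: add.assoc)
qed

theorem theorem4:
  fixes m :: nat and S :: "nat \<Rightarrow> (real ^ 3) set"
  assumes "m \<ge> 1"
    and "\<And>i. i \<in> {1..m} \<Longrightarrow> round_sphere (S i)"
  shows "finite (components (UNIV - (\<Union>i\<in>{1..m}. S i)))
    \<and> real (card (components (UNIV - (\<Union>i\<in>{1..m}. S i))))
        \<le> real m ^ 3 / 3 - real m ^ 2 + 8 * real m / 3
    \<and> real m ^ 3 / 3 - real m ^ 2 + 8 * real m / 3 = 2 * real (m choose 3) + 2 * real m"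
proof -
  obtain c r where cr: "\<And>i. i \<in> {1..m} \<Longrightarrow> r i > 0 \<and> S i = sphere (c i) (r i)"
    using assms(2) unfolding round_sphere_def by metis
  \<comment> \<open>Shifting the index by one lets sphere number \<open>k\<close> have exactly
    \<open>k\<close> predecessors.\<close>
  have "{1..m} = Suc ` {..<m}" by (simp add: image_Suc_lessThan)
  then have "(\<Union>i\<in>{1..m}. S i) = (\<Union>i<m. sphere (c (Suc i)) (r (Suc i)))"
    using cr by (auto simp: image_image)
  moreover have "components_le (UNIV - (\<Union>i<m. sphere (c (Suc i)) (r (Suc i))))
      (1 + (\<Sum>k<m. 1 + (\<Sum>i<k. max 1 (2 * i))))"
    using cr by (intro components_le_Compl_spheres) auto
  ultimately have "finite (components (UNIV - (\<Union>i\<in>{1..m}. S i)))"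
    and "card (components (UNIV - (\<Union>i\<in>{1..m}. S i))) \<le> 1 + (\<Sum>k<m. 1 + (\<Sum>i<k. max 1 (2 * i)))"
    by (auto simp: components_le_def)
  moreover from this(2) have "real (card (components (UNIV - (\<Union>i\<in>{1..m}. S i))))
      \<le> real m ^ 3 / 3 - real m ^ 2 + 8 * real m / 3"
    using sum_regions[OF assms(1)] by (metis of_nat_le_iff)
  moreover have "real m ^ 3 / 3 - real m ^ 2 + 8 * real m / 3 = 2 * real (m choose 3) + 2 * real m"
    by (simp add: real_choose_3 power3_eq_cube power2_eq_square field_simps)
  ultimately show ?thesis by blast
qed

end
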